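(* Let $\beta>0$, $\delta>0$, $y^\delta\in Y$, let $r:=\|A^*A\|<1$, and let $\gamma>2\beta$ be such that $\|Ax\|_Y^2\le\frac{\gamma r}{2}\|x\|_{\ell_2}^2$ for all $x\in\mathbb{R}^n$. Let $\mathbf{R}>0$, $x^0\in\mathbb{R}^n$, and let $\{x^k\}$ be generated by $$x^{k+1}=\mathbb{P}_{\mathbf{R}}\left(x^k+\frac{2\beta}{\gamma-2\beta}x^k-\frac{1}{\gamma-2\beta}A^*(Ax^k-y^\delta)\right),\qquad k=0,1,2,\dots,$$ where $\mathbf{R}$ is chosen according to Morozov's discrepancy principle: for given $\tau_2\ge\tau_1>1$, the computed solution $x_{\alpha,\beta}^\delta$ (the iterate of this sequence at which the iteration is stopped) satisfies $\tau_1\delta\le\|Ax_{\alpha,\beta}^\delta-y^\delta\|_Y\le\tau_2\delta$. Then there exists a subsequence of $\{x^k\}$ that converges to a stationary point $x^*\in B_{\mathbf{R}}$ of the problem of minimizing $\frac12\|Ax-y^\delta\|_Y^2-\beta\|x\|_{\ell_2}^2$ over $B_{\mathbf{R}}$, meaning that $$\left\langle 2\beta x^*-A^*(Ax^*-y^\delta),\,x-x^*\right\rangle\le0\qquad\text{for all }x\in B_{\mathbf{R}} .$$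
   Context: $\mathbb{R}^n$ carries the Euclidean inner product and norm $\|\cdot\|_{\ell_2}$; $Y$ is a Hilbert space; $A:\mathbb{R}^n\to Y$ is linear with adjoint $A^*$, and $\|A^*A\|$ is the operator norm. $B_{\mathbf{R}}=\{x\in\mathbb{R}^n:\|x\|_{\ell_1}\le\mathbf{R}\}$, and $\mathbb{P}_{\mathbf{R}}$ is the Euclidean metric projection onto $B_{\mathbf{R}}$. *)

theory Defs
  imports "HOL-Analysis.Analysis"
begin

definition l1_norm :: "real ^ 'n \<Rightarrow> real" where
  "l1_norm x = (\<Sum>i\<in>UNIV. \<bar>x $ i\<bar>)"

definition l1_ball :: "real \<Rightarrow> (real ^ 'n) set" where
  "l1_ball R = {x. l1_norm x \<le> R}"

text \<open>The library only shows that \<^const>\<open>adjoint\<close> has the adjoint property when the codomain is a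
  Euclidean space. The codomain here is an arbitrary Hilbert space; a finite-dimensional domain
  suffices.\<close>

lemma adjoint_works_euclidean_dom:
  fixes A :: "'a::euclidean_space \<Rightarrow> 'y::real_inner"
  assumes "linear A"
  shows "x \<bullet> adjoint A y = A x \<bullet> y"
proof -
  interpret linear A by fact
  define g where "g y = (\<Sum>i\<in>Basis. (A i \<bullet> y) *\<^sub>R i)" for y
  have "A x \<bullet> y = x \<bullet> g y" for x y
  proof -
    have "A x \<bullet> y = A (\<Sum>i\<in>Basis. (x \<bullet> i) *\<^sub>R i) \<bullet> y"
      by (simp add: euclidean_representation)
    also have "\<dots> = (\<Sum>i\<in>Basis. (x \<bullet> i) * (A i \<bullet> y))"
      by (simp add: sum scale inner_sum_left)
    also have "\<dots> = x \<bullet> g y"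
      by (simp add: g_def inner_sum_right mult.commute)
    finally show ?thesis .
  qed
  then show ?thesis
    using adjoint_unique[of A g] by simp
qed

definition residual_objective ::
  "(real ^ 'n \<Rightarrow> 'y::real_inner) \<Rightarrow> 'y \<Rightarrow> real \<Rightarrow> real ^ 'n \<Rightarrow> real" where
  "residual_objective A y \<beta> x = (norm (A x - y))\<^sup>2 / 2 - \<beta> * (norm x)\<^sup>2"

text \<open>First-order stationarity for minimizing \<^term>\<open>residual_objective A y \<beta>\<close> over the set \<open>S\<close>.
  The vector in the inner product is the negative gradient of the objective, as
  the next lemma shows.\<close>

definition stationary_point ::
  "(real ^ 'n \<Rightarrow> 'y::real_inner) \<Rightarrow> 'y \<Rightarrow> real \<Rightarrow> (real ^ 'n) set \<Rightarrow> real ^ 'n \<Rightarrow> bool" where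
  "stationary_point A y \<beta> S z \<longleftrightarrow>
     z \<in> S \<and> (\<forall>x\<in>S. ((2 * \<beta>) *\<^sub>R z - adjoint A (A z - y)) \<bullet> (x - z) \<le> 0)"

lemma residual_objective_has_derivative:
  fixes A :: "real ^ 'n \<Rightarrow> 'y::real_inner"
  assumes "linear A"
  shows "(residual_objective A y \<beta> has_derivative
           (\<lambda>h. - (((2 * \<beta>) *\<^sub>R z - adjoint A (A z - y)) \<bullet> h))) (at z)"
proof -
  have bl: "bounded_linear A"
    using assms by (rule linear_conv_bounded_linear[THEN iffD1])
  have A': "(A has_derivative A) (at z)"
    by (rule bounded_linear_imp_has_derivative[OF bl])
  have adj: "adjoint A w \<bullet> h = A h \<bullet> w" for w h
    using adjoint_works_euclidean_dom[OF assms, of h w] by (simp add: inner_commute)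
  have eq: "residual_objective A y \<beta>
      = (\<lambda>x. ((A x - y) \<bullet> (A x - y)) / 2 - \<beta> * (x \<bullet> x))"
    by (simp add: residual_objective_def fun_eq_iff power2_norm_eq_inner)
  show ?thesis
    unfolding eq
    by (rule has_derivative_eq_rhs)
       (auto intro!: derivative_eq_intros A'
         simp: fun_eq_iff adj adjoint_works_euclidean_dom[OF assms] inner_diff_left inner_diff_right inner_commute field_simps)
qed

end

theory Submission
  imports Defs
begin

text \<open>
  With \<open>s = \<gamma> - 2 * \<beta>\<close> and the negative gradient \<open>g z = 2 * \<beta> * z - A\<^sup>*(A z - y)\<close> of the objective \<open>F\<close>,
  the iteration reads \<open>x\<^sup>k\<^sup>+\<^sup>1 = P (x\<^sup>k + g x\<^sup>k / s)\<close>: it is a projected gradient method with step size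
  \<open>1 / s\<close>. Although \<open>F\<close> need not be convex, every
  step from a point of the ball, hence every step after the first, decreases it. For such a step the
  variational inequality of the projection gives \<open>g x\<^sup>k \<bullet> h \<ge> s * \<parallel>h\<parallel>\<^sup>2\<close> for the increment \<open>h = x\<^sup>k\<^sup>+\<^sup>1 - x\<^sup>k\<close>, and
  since \<open>F\<close> is quadratic its second-order term is \<open>\<parallel>A h\<parallel>\<^sup>2 / 2 - \<beta> * \<parallel>h\<parallel>\<^sup>2 \<le> (\<gamma> * r / 4 - \<beta>) * \<parallel>h\<parallel>\<^sup>2\<close>.
  Because \<open>r < 1\<close> and \<open>\<beta> < \<gamma> / 2\<close>, the factor \<open>\<gamma> * r / 4 - \<beta>\<close> is below \<open>s\<close>, so the step lowers \<open>F\<close> by at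
  least a positive multiple of \<open>\<parallel>h\<parallel>\<^sup>2\<close>.

  On the compact \<open>\<ell>\<^sub>1\<close> ball \<open>F\<close> is bounded below, so the increments tend to zero. A convergent
  subsequence exists by compactness; its limit is also the limit of the successors, hence by
  continuity a fixed point of the projected gradient step, and these fixed points are stationary.
  Lemma \<open>projected_gradient_accumulation\<close> carries this argument for an arbitrary compact convex set.
\<close>

text \<open>
  The projection makes an obtuse angle at \<open>p\<close> between the target \<open>z + v / s\<close> and the starting point \<open>z\<close>,
  so the increment points along \<open>v\<close> by a quantified amount.
\<close>

lemma projected_step_ascent:
  fixes S :: "'a::euclidean_space set"
  assumes "convex S" "closed S" "z \<in> S" "s > 0"
    and p: "p = closest_point S (z + (1 / s) *\<^sub>R v)"
  shows "v \<bullet> (p - z) \<ge> s * (norm (p - z))\<^sup>2"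
proof -
  have "(z + (1 / s) *\<^sub>R v - p) \<bullet> (z - p) \<le> 0"
    unfolding p by (rule closest_point_dot[OF assms(1-3)])
  then have "(norm (p - z))\<^sup>2 \<le> (1 / s) * (v \<bullet> (p - z))"
    by (simp add: power2_norm_eq_inner algebra_simps inner_commute)
  then show ?thesis
    using \<open>s > 0\<close> by (simp add: field_simps)
qed

lemma fixed_point_projected_step_stationary:
  fixes S :: "'a::euclidean_space set"
  assumes "convex S" "closed S" "s > 0" "u \<in> S"
    and fp: "z = closest_point S (z + (1 / s) *\<^sub>R v)"
  shows "v \<bullet> (u - z) \<le> 0"
proof -
  have "(z + (1 / s) *\<^sub>R v - z) \<bullet> (u - z) \<le> 0"
    using closest_point_dot[OF assms(1,2,4), of "z + (1 / s) *\<^sub>R v"] fp by simp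
  then show ?thesis
    using \<open>s > 0\<close> by (simp add: field_simps)
qed

text \<open>
  Here \<open>g\<close> plays the part of the negative gradient of \<open>F\<close>, and \<open>upper\<close> is the quadratic upper bound that
  a gradient with Lipschitz constant \<open>2 * M\<close> would provide; the step size \<open>1 / s\<close> beats it when
  \<open>M < s\<close>. The bound is only available inside \<open>S\<close>, and the initial point may lie outside, so the
  monotone decrease of \<open>F\<close> starts at the iterate with index one.
\<close>

lemma projected_gradient_accumulation:
  fixes S :: "'a::euclidean_space set" and F :: "'a \<Rightarrow> real"
  assumes S: "compact S" "convex S" "S \<noteq> {}"
    and F: "continuous_on S F" and g: "continuous_on S g"
    and upper: "\<And>z w. z \<in> S \<Longrightarrow> w \<in> S \<Longrightarrow> F w \<le> F z - g z \<bullet> (w - z) + M * (norm (w - z))\<^sup>2"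
    and s: "s > 0" "M < s"
    and step: "\<And>k. x (Suc k) = closest_point S (x k + (1 / s) *\<^sub>R g (x k))"
  shows "\<exists>l \<phi>. strict_mono (\<phi> :: nat \<Rightarrow> nat) \<and> (x \<circ> \<phi>) \<longlonglongrightarrow> l \<and> l \<in> S
           \<and> (\<forall>u\<in>S. g l \<bullet> (u - l) \<le> 0)"
proof -
  have cl: "closed S"
    using S(1) by (rule compact_imp_closed)
  define z where "z k = x (Suc k)" for k
  have zS: "z k \<in> S" for k
    by (simp add: z_def step closest_point_in_set[OF cl S(3)])
  have zstep: "z (Suc k) = closest_point S (z k + (1 / s) *\<^sub>R g (z k))" for k
    by (simp add: z_def step)
  have drop: "(s - M) * (norm (z (Suc k) - z k))\<^sup>2 \<le> F (z k) - F (z (Suc k))" for k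
    using upper[OF zS zS, of "Suc k" k]
      projected_step_ascent[OF S(2) cl zS s(1) zstep, of k]
    by (simp add: algebra_simps)
  have dec: "decseq (\<lambda>k. F (z k))"
  proof (rule decseq_SucI)
    fix k
    have "0 \<le> (s - M) * (norm (z (Suc k) - z k))\<^sup>2"
      using s(2) by simp
    with drop[of k] show "F (z (Suc k)) \<le> F (z k)"
      by linarith
  qed
  obtain m where m: "\<And>w. w \<in> S \<Longrightarrow> F m \<le> F w"
    using continuous_attains_inf[OF S(1,3) F] by blast
  obtain L where L: "(\<lambda>k. F (z k)) \<longlonglongrightarrow> L"
    using decseq_convergent[OF dec, of "F m"] m zS by blast
  have "(\<lambda>k. (F (z k) - F (z (Suc k))) / (s - M)) \<longlonglongrightarrow> (L - L) / (s - M)"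
    using s(2) by (intro tendsto_intros L LIMSEQ_Suc) auto
  then have "(\<lambda>k. (F (z k) - F (z (Suc k))) / (s - M)) \<longlonglongrightarrow> 0"
    by simp
  then have "(\<lambda>k. (norm (z (Suc k) - z k))\<^sup>2) \<longlonglongrightarrow> 0"
    by (rule tendsto_sandwich[OF _ _ tendsto_const, rotated 2])
       (use drop s(2) in \<open>auto simp: field_simps intro!: always_eventually\<close>)
  then have "(\<lambda>k. sqrt ((norm (z (Suc k) - z k))\<^sup>2)) \<longlonglongrightarrow> sqrt 0"
    by (rule tendsto_real_sqrt)
  then have incr: "(\<lambda>k. z (Suc k) - z k) \<longlonglongrightarrow> 0"
    by (simp add: tendsto_norm_zero_iff)
  obtain l \<psi> where l: "l \<in> S" and \<psi>: "strict_mono (\<psi> :: nat \<Rightarrow> nat)" and lim: "(z \<circ> \<psi>) \<longlonglongrightarrow> l"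
    using S(1) zS unfolding compact_def by blast
  have lim': "(\<lambda>k. z (\<psi> k)) \<longlonglongrightarrow> l"
    using lim by (simp add: o_def)
  have "(\<lambda>k. z (Suc (\<psi> k)) - z (\<psi> k)) \<longlonglongrightarrow> 0"
    using LIMSEQ_subseq_LIMSEQ[OF incr \<psi>] by (simp add: o_def)
  from tendsto_add[OF this lim'] have lim_Suc: "(\<lambda>k. z (Suc (\<psi> k))) \<longlonglongrightarrow> l"
    by simp
  have "(\<lambda>k. g (z (\<psi> k))) \<longlonglongrightarrow> g l"
    using continuous_on_tendsto_compose[OF g lim' l] zS by simp
  then have arg: "(\<lambda>k. z (\<psi> k) + (1 / s) *\<^sub>R g (z (\<psi> k))) \<longlonglongrightarrow> l + (1 / s) *\<^sub>R g l"
    by (intro tendsto_intros lim')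
  have "(\<lambda>k. z (Suc (\<psi> k))) \<longlonglongrightarrow> closest_point S (l + (1 / s) *\<^sub>R g l)"
    unfolding zstep by (rule isCont_tendsto_compose[OF continuous_at_closest_point arg])
      (use S cl in auto)
  with lim_Suc have fp: "l = closest_point S (l + (1 / s) *\<^sub>R g l)"
    by (rule LIMSEQ_unique)
  have "strict_mono (Suc \<circ> \<psi>)"
    using \<psi> by (simp add: strict_mono_def)
  moreover have "(x \<circ> (Suc \<circ> \<psi>)) \<longlonglongrightarrow> l"
    using lim' by (simp add: o_def z_def)
  moreover have "\<forall>u\<in>S. g l \<bullet> (u - l) \<le> 0"
    using fixed_point_projected_step_stationary[OF S(2) cl s(1) _ fp] by blast
  ultimately show ?thesis
    using l by blast
qed

lemma convex_l1_ball: "convex (l1_ball R)"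
proof (rule convexI)
  fix a b :: "real ^ 'n" and u v :: real
  assume ab: "a \<in> l1_ball R" "b \<in> l1_ball R" and uv: "0 \<le> u" "0 \<le> v" "u + v = 1"
  have "l1_norm (u *\<^sub>R a + v *\<^sub>R b) \<le> (\<Sum>i\<in>UNIV. u * \<bar>a $ i\<bar> + v * \<bar>b $ i\<bar>)"
    unfolding l1_norm_def
  proof (rule sum_mono)
    fix i
    show "\<bar>(u *\<^sub>R a + v *\<^sub>R b) $ i\<bar> \<le> u * \<bar>a $ i\<bar> + v * \<bar>b $ i\<bar>"
      using abs_triangle_ineq[of "u * a $ i" "v * b $ i"] uv by (simp add: abs_mult)
  qed
  also have "\<dots> = u * l1_norm a + v * l1_norm b"
    by (simp add: l1_norm_def sum.distrib sum_distrib_left)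
  also have "\<dots> \<le> R"
    using ab uv by (intro convex_bound_le) (auto simp: l1_ball_def)
  finally show "u *\<^sub>R a + v *\<^sub>R b \<in> l1_ball R"
    by (simp add: l1_ball_def)
qed

lemma compact_l1_ball: "compact (l1_ball R :: (real ^ 'n) set)"
proof -
  have "closed (l1_ball R :: (real ^ 'n) set)"
    unfolding l1_ball_def l1_norm_def by (intro closed_Collect_le continuous_intros)
  moreover have "bounded (l1_ball R :: (real ^ 'n) set)"
    unfolding bounded_iff l1_ball_def l1_norm_def
    using norm_le_l1_cart order.trans by blast
  ultimately show ?thesis
    by (simp add: compact_eq_bounded_closed)
qed

lemma zero_in_l1_ball: "R \<ge> 0 \<Longrightarrow> 0 \<in> l1_ball R"
  by (simp add: l1_ball_def l1_norm_def)

lemma linear_adjoint_euclidean_dom: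
  fixes A :: "'a::euclidean_space \<Rightarrow> 'y::real_inner"
  assumes "linear A"
  shows "linear (adjoint A)"
proof (rule linearI)
  fix u v :: 'y and c :: real
  show "adjoint A (u + v) = adjoint A u + adjoint A v"
    by (subst vector_eq_ldot[symmetric])
       (simp add: adjoint_works_euclidean_dom[OF assms] inner_add_right)
  show "adjoint A (c *\<^sub>R u) = c *\<^sub>R adjoint A u"
    by (subst vector_eq_ldot[symmetric])
       (simp add: adjoint_works_euclidean_dom[OF assms])
qed

text \<open>
  The objective is quadratic, so its second-order Taylor expansion is exact; the last bracket is half
  of the Hessian applied to the increment.
\<close>

lemma residual_objective_expansion:
  fixes A :: "real ^ 'n \<Rightarrow> 'y::real_inner"
  assumes "linear A"
  shows "residual_objective A y \<beta> w = residual_objective A y \<beta> z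
           - ((2 * \<beta>) *\<^sub>R z - adjoint A (A z - y)) \<bullet> (w - z)
           + ((norm (A (w - z)))\<^sup>2 / 2 - \<beta> * (norm (w - z))\<^sup>2)"
proof -
  have adj: "adjoint A u \<bullet> h = A h \<bullet> u" for u h
    using adjoint_works_euclidean_dom[OF assms, of h u] by (simp add: inner_commute)
  show ?thesis
    by (simp add: residual_objective_def power2_norm_eq_inner inner_diff_left adj
        linear_diff[OF assms])
       (simp add: inner_diff_left inner_diff_right inner_commute field_simps)
qed

theorem theorem5p8:
  fixes A :: "real ^ 'n \<Rightarrow> 'y::{real_inner, complete_space}"
    and y\<^sub>\<delta> :: 'y
    and \<beta> \<delta> r \<gamma> R \<tau>\<^sub>1 \<tau>\<^sub>2 :: real
    and x0 :: "real ^ 'n"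
    and x :: "nat \<Rightarrow> real ^ 'n"
    and K :: nat
  assumes "linear A"
    and "\<beta> > 0" and "\<delta> > 0"
    and "r = onorm (adjoint A \<circ> A)" and "r < 1"
    and "\<gamma> > 2 * \<beta>"
    and "\<And>z. (norm (A z))\<^sup>2 \<le> \<gamma> * r / 2 * (norm z)\<^sup>2"
    and "R > 0"
    and "x 0 = x0"
    and "\<And>k. x (Suc k) = closest_point (l1_ball R)
           (x k + (2 * \<beta> / (\<gamma> - 2 * \<beta>)) *\<^sub>R x k
              - (1 / (\<gamma> - 2 * \<beta>)) *\<^sub>R adjoint A (A (x k) - y\<^sub>\<delta>))"
    and "\<tau>\<^sub>1 > 1" and "\<tau>\<^sub>2 \<ge> \<tau>\<^sub>1"
    and "\<tau>\<^sub>1 * \<delta> \<le> norm (A (x K) - y\<^sub>\<delta>)"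
    and "norm (A (x K) - y\<^sub>\<delta>) \<le> \<tau>\<^sub>2 * \<delta>"
  shows "\<exists>xs \<phi>. strict_mono (\<phi> :: nat \<Rightarrow> nat)
           \<and> (x \<circ> \<phi>) \<longlonglongrightarrow> xs
           \<and> stationary_point A y\<^sub>\<delta> \<beta> (l1_ball R) xs"
proof -
  let ?F = "residual_objective A y\<^sub>\<delta> \<beta>"
  let ?g = "\<lambda>z. (2 * \<beta>) *\<^sub>R z - adjoint A (A z - y\<^sub>\<delta>)"
  let ?s = "\<gamma> - 2 * \<beta>"
  let ?M = "\<gamma> * r / 4 - \<beta>"
  have s: "?s > 0"
    using \<open>\<gamma> > 2 * \<beta>\<close> by simp
  have "\<gamma> * r < \<gamma>"
    using \<open>r < 1\<close> \<open>\<gamma> > 2 * \<beta>\<close> \<open>\<beta> > 0\<close> by simp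
  then have Ms: "?M < ?s"
    using \<open>\<gamma> > 2 * \<beta>\<close> \<open>\<beta> > 0\<close> by linarith
  have F: "continuous_on (l1_ball R) ?F"
    by (rule continuous_at_imp_continuous_on)
       (rule ballI, rule has_derivative_continuous,
        rule residual_objective_has_derivative[OF \<open>linear A\<close>])
  \<comment> \<open>\<open>Y\<close> may be infinite-dimensional, so linearity of the adjoint does not by itself yield its
    continuity; the splitting leaves it only composed with \<open>A\<close>, as a linear map on \<open>\<real>\<^sup>n\<close>, and in a
    constant.\<close>
  have g_split: "?g = (\<lambda>z. (2 * \<beta>) *\<^sub>R z - (adjoint A \<circ> A) z + adjoint A y\<^sub>\<delta>)"
    using linear_diff[OF linear_adjoint_euclidean_dom[OF \<open>linear A\<close>]] by auto
  have g: "continuous_on (l1_ball R) ?g"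
    unfolding g_split
    by (intro continuous_intros linear_continuous_on linear_conv_bounded_linear[THEN iffD1]
        linear_compose \<open>linear A\<close> linear_adjoint_euclidean_dom)
  have upper: "?F w \<le> ?F z - ?g z \<bullet> (w - z) + ?M * (norm (w - z))\<^sup>2" for z w
    using residual_objective_expansion[OF \<open>linear A\<close>, of y\<^sub>\<delta> \<beta> w z] assms(7)[of "w - z"]
    by (simp add: algebra_simps)
  have step: "x (Suc k) = closest_point (l1_ball R) (x k + (1 / ?s) *\<^sub>R ?g (x k))" for k
    unfolding assms(10) by (simp add: scaleR_diff_right add_diff_eq)
  have nonempty: "l1_ball R \<noteq> ({} :: (real ^ 'n) set)"
    using zero_in_l1_ball[of R] \<open>R > 0\<close> by auto
  show ?thesis
    unfolding stationary_point_def
    using projected_gradient_accumulation[where g = ?g and x = x,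
        OF compact_l1_ball convex_l1_ball nonempty F g upper s Ms step]
    by blast
qed

end
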